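(* Let $\mathcal{U}=\{h\in\mathbb{R}^m_+ : \|h\|_2\le1\}$. Then the set $$m^{1/4}\cdot\mathrm{conv}\Big(e_1,\dots,e_m,\tfrac1{\sqrt m}e\Big)$$ dominates $\mathcal{U}$, and the piecewise affine solution described in the context gives an $O(m^{1/4})$-approximation to $\Pi_{AR}(\mathcal{U})$; that is, there is an absolute constant $C$ such that, for every $m$ and all data $(A,B,c,d)$, this solution gives a $C\,m^{1/4}$-approximation for $\Pi_{AR}(\mathcal{U})$.
   Context: Vector inequalities are componentwise; $e_i$ is the $i$-th standard basis vector and $e$ the all-ones vector of $\mathbb{R}^m$; $(a)^+=\max(a,0)$; $\mathrm{conv}$ denotes convex hull. Two-stage adjustable robust problem $\Pi_{AR}(\mathcal{S})$: the data are $A\in\mathbb{R}_+^{m\times n}$, $B\in\mathbb{R}^{m\times n}$, $c,d\in\mathbb{R}^n_+$. For a set $\mathcal{S}\subseteq\mathbb{R}^m_+$, a feasible solution is a pair $(x,y(\cdot))$ with $x\in\mathbb{R}^n_+$, $y:\mathcal{S}\to\mathbb{R}^n_+$ and $Ax+By(h)\ge h$ for all $h\in\mathcal{S}$; the optimal value $z_{AR}(\mathcal{S})$ is the minimum (infimum) over feasible solutions of the worst-case cost $c^Tx+\max_{h\in\mathcal{S}}d^Ty(h)$ (max read as supremum; value $+\infty$ if infeasible). An optimal solution is a feasible solution whose worst-case cost equals $z_{AR}(\mathcal{S})<\infty$. A solution $(x,y(\cdot))$ gives an $\alpha$-approximation for $\Pi_{AR}(\mathcal{U})$ if it is feasible for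 $\Pi_{AR}(\mathcal{U})$ and $c^Tx+d^Ty(h)\le\alpha\cdot z_{AR}(\mathcal{U})$ for all $h\in\mathcal{U}$. Domination: $\hat{\mathcal{U}}\subseteq\mathbb{R}^m_+$ dominates $\mathcal{U}$ if for every $h\in\mathcal{U}$ there is $\hat h\in\hat{\mathcal{U}}$ with $\hat h\ge h$. Piecewise affine solution: for $k=1,\dots,m$ put $\gamma(k)=\frac1k\max\{\sum_{i=1}^kh_i:h\in\mathcal{U}\}$, $\gamma=\gamma(m)$ and $\beta=\max_{k=1,\dots,m}\gamma(k)/(\gamma+\frac1k)$. Let $(\hat x,\hat y(\cdot))$ be an optimal solution (assumed to exist) of $\Pi_{AR}$ over $\beta\cdot\mathrm{conv}(e_1,\dots,e_m,\gamma e)$. The piecewise affine solution is $x=2\hat x$, $y(h)=\frac1\beta\sum_{i=1}^m(h_i-\beta\gamma)^+\hat y(\beta e_i)+\hat y(\beta\gamma e)$ for $h\in\mathcal{U}$. *)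

theory Defs
  imports
    "Jordan_Normal_Form.Matrix"
    "HOL-Library.Extended_Real"
    "HOL-Analysis.L2_Norm"
begin

text \<open>
  Vectors are \<open>real vec\<close> with an explicit dimension, because the approximation constant has to be
  uniform in the dimension. Indices run from \<open>0\<close>, so \<open>unit_vec m i\<close> with \<open>i < m\<close> is the
  \<open>(i + 1)\<close>-st standard basis vector. The order \<open>u \<le> v\<close> on \<open>real vec\<close> is componentwise and
  includes equality of dimensions; hence \<open>0\<^sub>v n \<le> x\<close> says \<open>x\<close> is a nonnegative vector of
  dimension \<open>n\<close>.
\<close>

definition nonneg_orthant :: "nat \<Rightarrow> real vec set" where
  "nonneg_orthant n = {x. 0\<^sub>v n \<le> x}"

definition ones_vec :: "nat \<Rightarrow> real vec" where
  "ones_vec m = vec m (\<lambda>_. 1)"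

definition scale_set :: "real \<Rightarrow> real vec set \<Rightarrow> real vec set" where
  "scale_set a S = (\<lambda>v. a \<cdot>\<^sub>v v) ` S"

text \<open>\<open>real vec\<close> is not a \<open>real_vector\<close> type (the zero depends on the dimension), so the library
  \<open>convex\<close> does not apply; convexity is relativised to \<open>carrier_vec m\<close>.\<close>

definition convex_vec :: "nat \<Rightarrow> real vec set \<Rightarrow> bool" where
  "convex_vec m K \<longleftrightarrow> K \<subseteq> carrier_vec m \<and>
     (\<forall>u\<in>K. \<forall>v\<in>K. \<forall>s\<ge>0. \<forall>t\<ge>0. s + t = 1 \<longrightarrow> s \<cdot>\<^sub>v u + t \<cdot>\<^sub>v v \<in> K)"

definition conv :: "nat \<Rightarrow> real vec set \<Rightarrow> real vec set" where
  "conv m V = convex_vec m hull V"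

definition conv_basis :: "nat \<Rightarrow> real \<Rightarrow> real vec set" where
  "conv_basis m g = conv m (insert (g \<cdot>\<^sub>v ones_vec m) (unit_vec m ` {..<m}))"

definition dominates :: "nat \<Rightarrow> real vec set \<Rightarrow> real vec set \<Rightarrow> bool" where
  "dominates m U' U \<longleftrightarrow> U' \<subseteq> nonneg_orthant m \<and> (\<forall>h\<in>U. \<exists>h'\<in>U'. h \<le> h')"

definition ar_data ::
  "nat \<Rightarrow> nat \<Rightarrow> real mat \<Rightarrow> real mat \<Rightarrow> real vec \<Rightarrow> real vec \<Rightarrow> bool" where
  "ar_data m n A B c d \<longleftrightarrow>
     A \<in> carrier_mat m n \<and> 0\<^sub>m m n \<le> A \<and> B \<in> carrier_mat m n \<and>
     c \<in> nonneg_orthant n \<and> d \<in> nonneg_orthant n"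

text \<open>A recourse policy is a total function; only its values on the uncertainty set \<open>S\<close> matter.\<close>

definition ar_feasible ::
  "nat \<Rightarrow> real mat \<Rightarrow> real mat \<Rightarrow> real vec set \<Rightarrow> real vec \<Rightarrow> (real vec \<Rightarrow> real vec) \<Rightarrow> bool" where
  "ar_feasible n A B S x y \<longleftrightarrow>
     x \<in> nonneg_orthant n \<and>
     (\<forall>h\<in>S. y h \<in> nonneg_orthant n \<and> h \<le> A *\<^sub>v x + B *\<^sub>v y h)"

definition worst_case_cost ::
  "real vec \<Rightarrow> real vec \<Rightarrow> real vec set \<Rightarrow> real vec \<Rightarrow> (real vec \<Rightarrow> real vec) \<Rightarrow> ereal" where
  "worst_case_cost c d S x y = ereal (c \<bullet> x) + (SUP h\<in>S. ereal (d \<bullet> y h))"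

text \<open>The infimum of the empty set in \<open>ereal\<close> is \<open>\<infinity>\<close>, as wanted for an infeasible problem.\<close>

definition z_AR ::
  "nat \<Rightarrow> real mat \<Rightarrow> real mat \<Rightarrow> real vec \<Rightarrow> real vec \<Rightarrow> real vec set \<Rightarrow> ereal" where
  "z_AR n A B c d S = Inf {worst_case_cost c d S x y | x y. ar_feasible n A B S x y}"

definition ar_optimal ::
  "nat \<Rightarrow> real mat \<Rightarrow> real mat \<Rightarrow> real vec \<Rightarrow> real vec \<Rightarrow> real vec set
    \<Rightarrow> real vec \<Rightarrow> (real vec \<Rightarrow> real vec) \<Rightarrow> bool" where
  "ar_optimal n A B c d S x y \<longleftrightarrow>
     ar_feasible n A B S x y \<and>
     worst_case_cost c d S x y = z_AR n A B c d S \<and> z_AR n A B c d S < \<infinity>"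

definition ar_approx ::
  "real \<Rightarrow> nat \<Rightarrow> real mat \<Rightarrow> real mat \<Rightarrow> real vec \<Rightarrow> real vec \<Rightarrow> real vec set
    \<Rightarrow> real vec \<Rightarrow> (real vec \<Rightarrow> real vec) \<Rightarrow> bool" where
  "ar_approx \<alpha> n A B c d U x y \<longleftrightarrow>
     ar_feasible n A B U x y \<and>
     (\<forall>h\<in>U. ereal (c \<bullet> x + d \<bullet> y h) \<le> ereal \<alpha> * z_AR n A B c d U)"

text \<open>The supremum stands for the maximum, which is attained for compact nonempty \<open>U\<close>.\<close>

definition pa_gamma :: "real vec set \<Rightarrow> nat \<Rightarrow> real" where
  "pa_gamma U k = (SUP h\<in>U. \<Sum>i<k. h $ i) / real k"

definition pa_beta :: "nat \<Rightarrow> real vec set \<Rightarrow> real" where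
  "pa_beta m U = Max ((\<lambda>k. pa_gamma U k / (pa_gamma U m + 1 / real k)) ` {1..m})"

definition pa_set :: "nat \<Rightarrow> real vec set \<Rightarrow> real vec set" where
  "pa_set m U = scale_set (pa_beta m U) (conv_basis m (pa_gamma U m))"

definition pa_x :: "real vec \<Rightarrow> real vec" where
  "pa_x x' = 2 \<cdot>\<^sub>v x'"

definition pa_y ::
  "nat \<Rightarrow> nat \<Rightarrow> real vec set \<Rightarrow> (real vec \<Rightarrow> real vec) \<Rightarrow> real vec \<Rightarrow> real vec" where
  "pa_y m n U y' h =
     (let \<beta> = pa_beta m U; \<gamma> = pa_gamma U m in
       (1 / \<beta>) \<cdot>\<^sub>v finsum_vec TYPE(real) n
           (\<lambda>i. max (h $ i - \<beta> * \<gamma>) 0 \<cdot>\<^sub>v y' (\<beta> \<cdot>\<^sub>v unit_vec m i)) {..<m}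
       + y' ((\<beta> * \<gamma>) \<cdot>\<^sub>v ones_vec m))"

definition nonneg_unit_ball :: "nat \<Rightarrow> real vec set" where
  "nonneg_unit_ball m = {h \<in> nonneg_orthant m. L2_set (\<lambda>i. h $ i) {..<m} \<le> 1}"

end

theory Submission
  imports Defs
begin

text \<open>
  For the unit ball, \<open>\<gamma>(k) = 1 / sqrt k\<close> by Cauchy--Schwarz, so \<open>2 \<beta> \<le> m powr (1/4)\<close> by AM--GM.
  Every \<open>h\<close> in the ball is covered by \<open>\<Sum>\<^sub>i w\<^sub>i e\<^sub>i + \<beta>\<gamma> e\<close> with \<open>w\<^sub>i = (h\<^sub>i - \<beta>\<gamma>)\<^sup>+\<close>, and
  \<open>\<Sum>\<^sub>i w\<^sub>i \<le> \<beta>\<close> by applying the definition of \<open>\<beta>\<close> to the number \<open>k\<close> of nonzero \<open>w\<^sub>i\<close>. Hence one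
  copy of \<open>x'\<close> pays for \<open>\<beta>\<gamma> e\<close>, a second one for the subconvex combination \<open>\<Sum>\<^sub>i (w\<^sub>i/\<beta>) \<beta>e\<^sub>i\<close>,
  and the cost at most doubles. Finally, \<open>conv (e\<^sub>1, \<dots>, e\<^sub>m, \<gamma> e)\<close> lies in the ball, so by
  homogeneity the optimum over \<open>\<beta> conv (e\<^sub>1, \<dots>, e\<^sub>m, \<gamma> e)\<close> is at most \<open>\<beta>\<close> times the optimum over
  the ball. The constant is therefore \<open>C = 1\<close>.
\<close>

subsection \<open>Nonnegative vectors and convex hulls\<close>

lemma nonneg_orthant_iff:
  "v \<in> nonneg_orthant m \<longleftrightarrow> v \<in> carrier_vec m \<and> (\<forall>i<m. 0 \<le> v $ i)"
  by (auto simp: nonneg_orthant_def less_eq_vec_def)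

lemma scalar_prod_nonneg_orthant:
  "c \<in> nonneg_orthant n \<Longrightarrow> x \<in> nonneg_orthant n \<Longrightarrow> 0 \<le> c \<bullet> x"
  by (auto simp: nonneg_orthant_iff scalar_prod_def intro!: sum_nonneg)

lemma smult_nonneg_orthant:
  "0 \<le> a \<Longrightarrow> x \<in> nonneg_orthant n \<Longrightarrow> a \<cdot>\<^sub>v x \<in> nonneg_orthant n"
  by (auto simp: nonneg_orthant_iff)

lemma add_nonneg_orthant:
  "u \<in> nonneg_orthant n \<Longrightarrow> v \<in> nonneg_orthant n \<Longrightarrow> u + v \<in> nonneg_orthant n"
  by (auto simp: nonneg_orthant_iff)

lemma less_eq_vecD: "u \<le> v \<Longrightarrow> i < dim_vec v \<Longrightarrow> u $ i \<le> v $ i"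
  by (simp add: less_eq_vec_def)

lemma convex_vec_nonneg_orthant: "convex_vec m (nonneg_orthant m)"
  by (auto simp: convex_vec_def nonneg_orthant_iff)

lemma conv_subset: "V \<subseteq> K \<Longrightarrow> convex_vec m K \<Longrightarrow> conv m V \<subseteq> K"
  unfolding conv_def by (rule hull_minimal)

lemma conv_basis_subset:
  assumes "convex_vec m K" "\<And>i. i < m \<Longrightarrow> unit_vec m i \<in> K" "g \<cdot>\<^sub>v ones_vec m \<in> K"
  shows "conv_basis m g \<subseteq> K"
  unfolding conv_basis_def using assms by (intro conv_subset) auto

lemma unit_vec_in_conv_basis: "i < m \<Longrightarrow> unit_vec m i \<in> conv_basis m g"
  unfolding conv_basis_def conv_def by (rule hull_inc) auto

lemma ones_vec_in_conv_basis: "g \<cdot>\<^sub>v ones_vec m \<in> conv_basis m g"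
  unfolding conv_basis_def conv_def by (rule hull_inc) auto

text \<open>\<open>convex_vec\<close> speaks of two points only; induction on the index set extends
  it to finite convex combinations. The combination is written coordinatewise, which avoids
  vector-valued sums.\<close>

lemma convex_vec_sum:
  assumes K: "convex_vec m K" and "finite I"
    and "\<And>i. i \<in> I \<Longrightarrow> u i \<in> K" "\<And>i. i \<in> I \<Longrightarrow> 0 \<le> w i" "sum w I = 1"
  shows "vec m (\<lambda>j. \<Sum>i\<in>I. w i * u i $ j) \<in> K"
  using assms(2-)
proof (induction I arbitrary: w rule: finite_induct)
  case empty
  then show ?case by simp
next
  case (insert a I)
  have dims: "dim_vec (u a) = m"
    using insert.prems(1)[of a] K by (auto simp: convex_vec_def)
  show ?case
  proof (cases "sum w I = 0")
    \<comment> \<open>Total weight 0 on \<open>I\<close> rules out renormalising; then all the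
      weight sits on \<open>a\<close>.\<close>
    case True
    then have "\<And>i. i \<in> I \<Longrightarrow> w i = 0" "w a = 1"
      using insert by (auto simp: sum_nonneg_eq_0_iff)
    then have "vec m (\<lambda>j. \<Sum>i\<in>insert a I. w i * u i $ j) = u a"
      using insert.hyps dims by (intro eq_vecI) auto
    then show ?thesis using insert.prems by simp
  next
    case False
    \<comment> \<open>The points indexed by \<open>I\<close> are merged into one point
      \<open>v\<close> by renormalising their weights with \<open>s\<close>; what remains is a
      combination of the two points \<open>u a\<close> and \<open>v\<close>.\<close>
    define s where "s = sum w I"
    have s: "0 < s" "w a + s = 1"
      using False insert by (auto simp: s_def order_less_le intro: sum_nonneg)
    define v where "v = vec m (\<lambda>j. \<Sum>i\<in>I. w i / s * u i $ j)"
    have "v \<in> K"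
      unfolding v_def using insert.prems s
      by (intro insert.IH) (auto simp: s_def simp flip: sum_divide_distrib)
    then have "w a \<cdot>\<^sub>v u a + s \<cdot>\<^sub>v v \<in> K"
      using K insert.prems s by (auto simp: convex_vec_def)
    moreover have "w a \<cdot>\<^sub>v u a + s \<cdot>\<^sub>v v = vec m (\<lambda>j. \<Sum>i\<in>insert a I. w i * u i $ j)"
      using insert.hyps dims s
      by (intro eq_vecI) (auto simp: v_def sum_distrib_left)
    ultimately show ?thesis by simp
  qed
qed

text \<open>Supplies explicit points of the hull: weight \<open>w i\<close> on each unit vector and
  \<open>s\<close> on the all-ones generator.\<close>

lemma conv_basis_combination:
  assumes w: "\<And>i. i < m \<Longrightarrow> 0 \<le> w i" and "0 \<le> s" "(\<Sum>i<m. w i) + s = 1"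
  shows "vec m (\<lambda>j. w j + s * g) \<in> conv_basis m g"
proof -
  \<comment> \<open>The \<open>m + 1\<close> generators are indexed by \<open>{..<Suc m}\<close>;
    the extra index \<open>m\<close> stands for the all-ones generator.\<close>
  define u where "u i = (if i < m then unit_vec m i else g \<cdot>\<^sub>v ones_vec m)" for i
  define w' where "w' i = (if i < m then w i else s)" for i
  have eq: "vec m (\<lambda>j. \<Sum>i<Suc m. w' i * u i $ j) = vec m (\<lambda>j. w j + s * g)"
    by (intro eq_vecI)
      (auto simp: u_def w'_def ones_vec_def if_distrib if_distribR sum.delta cong: if_cong)
  \<comment> \<open>The hull is an intersection, so membership is checked in each convex
    \<open>K\<close> containing the generators.\<close>
  have "vec m (\<lambda>j. w j + s * g) \<in> K"
    if "convex_vec m K" "insert (g \<cdot>\<^sub>v ones_vec m) (unit_vec m ` {..<m}) \<subseteq> K" for K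
    unfolding eq[symmetric] using that assms
    by (intro convex_vec_sum) (auto simp: u_def w'_def)
  then show ?thesis by (auto simp: conv_basis_def conv_def hull_def)
qed

subsection \<open>The nonnegative unit ball\<close>

lemma nonneg_unit_ball_sum_squares:
  "h \<in> nonneg_unit_ball m \<Longrightarrow> (\<Sum>i<m. (h $ i)\<^sup>2) \<le> 1"
  by (auto simp: nonneg_unit_ball_def L2_set_def)

lemma nonneg_unit_ball_nonneg:
  "h \<in> nonneg_unit_ball m \<Longrightarrow> h \<in> carrier_vec m \<and> (\<forall>i<m. 0 \<le> h $ i)"
  by (auto simp: nonneg_unit_ball_def nonneg_orthant_iff)

lemma convex_vec_nonneg_unit_ball: "convex_vec m (nonneg_unit_ball m)"
proof -
  have "L2_set (\<lambda>i. (s \<cdot>\<^sub>v u + t \<cdot>\<^sub>v v) $ i) {..<m} \<le> 1"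
    if "u \<in> nonneg_unit_ball m" "v \<in> nonneg_unit_ball m" "0 \<le> s" "0 \<le> t" "s + t = 1" for u v s t
  proof -
    have "L2_set (\<lambda>i. (s \<cdot>\<^sub>v u + t \<cdot>\<^sub>v v) $ i) {..<m} = L2_set (\<lambda>i. s * u $ i + t * v $ i) {..<m}"
      using that by (intro L2_set_cong) (auto simp: nonneg_unit_ball_def nonneg_orthant_iff)
    also have "\<dots> \<le> s * L2_set (\<lambda>i. u $ i) {..<m} + t * L2_set (\<lambda>i. v $ i) {..<m}"
      using that by (simp add: L2_set_right_distrib L2_set_triangle_ineq)
    also have "\<dots> \<le> s * 1 + t * 1"
      using that by (intro add_mono mult_left_mono) (auto simp: nonneg_unit_ball_def)
    finally show ?thesis using that by simp
  qed
  then show ?thesis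
    using convex_vec_nonneg_orthant[of m] unfolding convex_vec_def nonneg_unit_ball_def by auto
qed

text \<open>Cauchy-Schwarz against the all-ones vector on \<open>S\<close>. Initial segments
  \<open>S\<close> give \<gamma>(k); superlevel sets of \<open>h\<close> appear in the bound on the
  total excess.\<close>

lemma sum_nonneg_unit_ball_le:
  assumes "h \<in> nonneg_unit_ball m" "S \<subseteq> {..<m}"
  shows "(\<Sum>i\<in>S. h $ i) \<le> sqrt (card S)"
proof -
  have "(\<Sum>i\<in>S. h $ i) \<le> (\<Sum>i\<in>S. \<bar>h $ i\<bar> * \<bar>1\<bar>)"
    by (intro sum_mono) simp
  also have "\<dots> \<le> L2_set (\<lambda>i. h $ i) S * L2_set (\<lambda>_. 1) S"
    by (rule L2_set_mult_ineq)
  also have "\<dots> \<le> 1 * sqrt (card S)"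
  proof (rule mult_mono)
    have "(\<Sum>i\<in>S. (h $ i)\<^sup>2) \<le> (\<Sum>i<m. (h $ i)\<^sup>2)"
      using assms(2) by (intro sum_mono2) auto
    then show "L2_set (\<lambda>i. h $ i) S \<le> 1"
      using nonneg_unit_ball_sum_squares[OF assms(1)] by (simp add: L2_set_def)
  qed (simp_all add: L2_set_def)
  finally show ?thesis by simp
qed

text \<open>The maximiser for \<gamma>(k), where Cauchy-Schwarz is tight. For \<open>k = m\<close>
  it is the all-ones generator of the hull.\<close>

lemma initial_segment_in_nonneg_unit_ball:
  assumes "1 \<le> k" "k \<le> m"
  shows "vec m (\<lambda>i. if i < k then 1 / sqrt (real k) else 0) \<in> nonneg_unit_ball m"
proof -
  have "(\<Sum>i<m. (vec m (\<lambda>i. if i < k then 1 / sqrt (real k) else 0) $ i)\<^sup>2)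
      = (\<Sum>i<m. if i < k then 1 / real k else 0)"
    by (intro sum.cong) (auto simp: power_divide)
  also have "\<dots> = (\<Sum>i<k. 1 / real k)"
    using assms by (intro sum.mono_neutral_cong_right) auto
  also have "\<dots> = 1" using assms by simp
  finally have "(\<Sum>i<m. (vec m (\<lambda>i. if i < k then 1 / sqrt (real k) else 0) $ i)\<^sup>2) = 1" .
  then show ?thesis
    by (auto simp: nonneg_unit_ball_def nonneg_orthant_iff L2_set_def)
qed

lemma pa_gamma_nonneg_unit_ball:
  assumes "1 \<le> k" "k \<le> m"
  shows "pa_gamma (nonneg_unit_ball m) k = 1 / sqrt (real k)"
proof -
  have "(SUP h\<in>nonneg_unit_ball m. \<Sum>i<k. h $ i) = sqrt (real k)"
  proof (rule cSup_eq_maximum)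
    let ?h = "vec m (\<lambda>i. if i < k then 1 / sqrt (real k) else 0)"
    have "(\<Sum>i<k. ?h $ i) = sqrt (real k)"
      using assms by (simp add: real_div_sqrt)
    then show "sqrt (real k) \<in> (\<lambda>h. \<Sum>i<k. h $ i) ` nonneg_unit_ball m"
      using initial_segment_in_nonneg_unit_ball[OF assms] by (intro image_eqI) auto
  next
    fix s assume "s \<in> (\<lambda>h. \<Sum>i<k. h $ i) ` nonneg_unit_ball m"
    then show "s \<le> sqrt (real k)"
      using sum_nonneg_unit_ball_le[of _ m "{..<k}"] assms by auto
  qed
  then show ?thesis
    by (simp add: pa_gamma_def sqrt_divide_self_eq inverse_eq_divide)
qed

lemma unit_vec_in_nonneg_unit_ball:
  assumes "i < m"
  shows "unit_vec m i \<in> nonneg_unit_ball m"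
proof -
  have "(\<Sum>j<m. (unit_vec m i $ j)\<^sup>2) = (\<Sum>j<m. if j = i then 1 else 0 :: real)"
    using assms by (intro sum.cong) auto
  then show ?thesis
    using assms by (auto simp: nonneg_unit_ball_def nonneg_orthant_iff L2_set_def)
qed

lemma ones_vec_in_nonneg_unit_ball:
  assumes "1 \<le> m"
  shows "(1 / sqrt (real m)) \<cdot>\<^sub>v ones_vec m \<in> nonneg_unit_ball m"
proof -
  have "vec m (\<lambda>i. if i < m then 1 / sqrt (real m) else 0) = (1 / sqrt (real m)) \<cdot>\<^sub>v ones_vec m"
    by (intro eq_vecI) (auto simp: ones_vec_def)
  then show ?thesis
    using initial_segment_in_nonneg_unit_ball[of m m] assms by simp
qed

text \<open>All generators are nonnegative unit vectors in the Euclidean norm, and the ball is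
  convex. After scaling, this inclusion compares the two optimal values.\<close>

lemma conv_basis_subset_nonneg_unit_ball:
  "1 \<le> m \<Longrightarrow> conv_basis m (1 / sqrt (real m)) \<subseteq> nonneg_unit_ball m"
  by (intro conv_basis_subset convex_vec_nonneg_unit_ball unit_vec_in_nonneg_unit_ball
      ones_vec_in_nonneg_unit_ball)

section \<open>Domination of the ball by the scaled hull\<close>

lemma powr_quarter_square: "(real m powr (1/4))\<^sup>2 = sqrt (real m)"
proof -
  have "(real m powr (1/4))\<^sup>2 = real m powr (1/4 + 1/4)"
    by (simp add: power2_eq_square flip: powr_add)
  then show ?thesis by (simp add: powr_half_sqrt)
qed

text \<open>Cutting \<open>h\<close> at height \<open>t\<close> leaves an excess of total mass at
  most \<open>b / 2\<close>. Half of the convex weight thus suffices for the unit vectors, and the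
  other half, on the all-ones generator, restores the height \<open>t\<close>. The argument is
  direct and does not pass through \<open>pa_beta\<close>.\<close>

lemma dominates_nonneg_unit_ball:
  assumes m: "1 \<le> m"
  shows "dominates m (scale_set (real m powr (1/4)) (conv_basis m (1 / sqrt (real m))))
    (nonneg_unit_ball m)"
proof -
  define b where "b = real m powr (1/4)"
  \<comment> \<open>As \<open>sqrt (real m) = b\<^sup>2\<close>, the all-ones generator scaled by
    \<open>b\<close> has entries \<open>1 / b\<close>; weight 1/2 on it contributes \<open>t\<close>
    to every coordinate.\<close>
  define t where "t = 1 / (2 * b)"
  have b: "0 < b" using m by (simp add: b_def)
  have bg: "b * (1 / sqrt (real m)) = 2 * t"
    using b by (simp add: t_def powr_quarter_square[symmetric] b_def[symmetric] power2_eq_square)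
  have "scale_set b (conv_basis m (1 / sqrt (real m))) \<subseteq> nonneg_orthant m"
    using conv_basis_subset_nonneg_unit_ball[OF m] b
    by (auto simp: scale_set_def nonneg_unit_ball_def intro!: smult_nonneg_orthant)
  moreover have "\<exists>h'\<in>scale_set b (conv_basis m (1 / sqrt (real m))). h \<le> h'"
    if h: "h \<in> nonneg_unit_ball m" for h
  proof -
    define w where "w i = max (h $ i - t) 0" for i
    have t: "0 < t" using b by (simp add: t_def)
    have "w i \<le> (h $ i)\<^sup>2 * (b / 2)" for i
    proof -
      \<comment> \<open>\<open>a - t \<le> a\<^sup>2 / (4 t)\<close>, since \<open>(a - 2 t)\<^sup>2 \<ge> 0\<close>\<close>
      have "4 * t * (h $ i - t) \<le> (h $ i)\<^sup>2"
        using zero_le_power2[of "h $ i - 2 * t"] by (simp add: power2_eq_square algebra_simps)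
      then have "h $ i - t \<le> (h $ i)\<^sup>2 * (b / 2)"
        using b by (simp add: t_def field_simps)
      then show ?thesis using b unfolding w_def by (intro max.boundedI) auto
    qed
    then have "(\<Sum>i<m. w i) \<le> (\<Sum>i<m. (h $ i)\<^sup>2) * (b / 2)"
      unfolding sum_distrib_right by (intro sum_mono)
    also have "\<dots> \<le> 1 * (b / 2)"
      using nonneg_unit_ball_sum_squares[OF h] b by (intro mult_right_mono) auto
    finally have W: "(\<Sum>i<m. w i / b) \<le> 1 / 2"
      using b by (simp add: field_simps flip: sum_divide_distrib)
    \<comment> \<open>All weight left over goes to the all-ones generator, so that the weights sum
      to exactly 1; any part beyond 1/2 only raises the point.\<close>
    define s where "s = 1 - (\<Sum>i<m. w i / b)"
    have s: "1 / 2 \<le> s" using W by (simp add: s_def)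
    define v where "v = vec m (\<lambda>i. w i / b + s * (1 / sqrt (real m)))"
    have "v \<in> conv_basis m (1 / sqrt (real m))"
      unfolding v_def
    proof (rule conv_basis_combination)
      show "0 \<le> w i / b" for i using b by (simp add: w_def)
    qed (use s in \<open>auto simp: s_def\<close>)
    moreover have "h \<le> b \<cdot>\<^sub>v v"
    proof -
      have "h $ i \<le> b * v $ i" if "i < m" for i
      proof -
        have "b * v $ i = w i + s * (b * (1 / sqrt (real m)))"
          using that b by (simp add: v_def algebra_simps)
        also have "\<dots> = w i + t + (2 * s - 1) * t" by (simp only: bg) (simp add: algebra_simps)
        finally have "b * v $ i \<ge> w i + t" using s t by simp
        then show ?thesis by (simp add: w_def)
      qed
      then show ?thesis
        using nonneg_unit_ball_nonneg[OF h] by (auto simp: less_eq_vec_def v_def)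
    qed
    ultimately show ?thesis by (auto simp: scale_set_def)
  qed
  ultimately show ?thesis by (auto simp: dominates_def b_def)
qed

subsection \<open>The scaling factor\<close>

lemma pa_beta_nonneg_unit_ball_ge:
  assumes "1 \<le> k" "k \<le> m"
  shows "(1 / sqrt (real k)) / (1 / sqrt (real m) + 1 / real k) \<le> pa_beta m (nonneg_unit_ball m)"
  unfolding pa_beta_def using assms
  by (intro Max_ge) (auto intro!: image_eqI[where x = k] simp: pa_gamma_nonneg_unit_ball)

text \<open>The policy divides by \<beta>. The entry \<open>k = m\<close> of the maximum is already
  positive.\<close>

lemma pa_beta_nonneg_unit_ball_pos:
  assumes "1 \<le> m"
  shows "0 < pa_beta m (nonneg_unit_ball m)"
proof -
  have "0 < (1 / sqrt (real m)) / (1 / sqrt (real m) + 1 / real m)"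
    using assms by (intro divide_pos_pos add_pos_pos) auto
  also have "\<dots> \<le> pa_beta m (nonneg_unit_ball m)"
    using assms by (intro pa_beta_nonneg_unit_ball_ge) auto
  finally show ?thesis .
qed

text \<open>The factor 2 gained from AM-GM later absorbs the doubled cost of the policy, so no
  constant is lost.\<close>

lemma pa_beta_nonneg_unit_ball_le:
  assumes "1 \<le> m"
  shows "2 * pa_beta m (nonneg_unit_ball m) \<le> real m powr (1/4)"
proof -
  define b where "b = real m powr (1/4)"
  have b: "0 < b" "sqrt (real m) = b\<^sup>2"
    using assms by (simp_all add: b_def powr_quarter_square)
  have "(1 / sqrt (real k)) / (1 / sqrt (real m) + 1 / real k) \<le> b / 2" if k: "1 \<le> k" for k
  proof -
    \<comment> \<open>With \<open>a = sqrt (real k)\<close> and \<open>b\<close>, the entry for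
      \<open>k\<close> becomes the rational function
      \<open>a * b\<^sup>2 / (a\<^sup>2 + b\<^sup>2)\<close>, and
      \<open>2 * a * b \<le> a\<^sup>2 + b\<^sup>2\<close> applies.\<close>
    define a where "a = sqrt (real k)"
    have a: "0 < a" "real k = a\<^sup>2" using k by (simp_all add: a_def)
    have "(1 / a) / (1 / b\<^sup>2 + 1 / a\<^sup>2) = a * b\<^sup>2 / (a\<^sup>2 + b\<^sup>2)"
      using a b by (simp add: field_simps power2_eq_square)
    also have "\<dots> \<le> b / 2"
    proof -
      have "b * (2 * a * b) \<le> b * (a\<^sup>2 + b\<^sup>2)"
        using b sum_squares_bound[of a b] by (intro mult_left_mono) auto
      moreover have "0 < a\<^sup>2 + b\<^sup>2" using a by (simp add: add_pos_nonneg)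
      ultimately show ?thesis by (simp add: field_simps power2_eq_square)
    qed
    finally show ?thesis unfolding a_def[symmetric] unfolding a(2) b(2) .
  qed
  then have "pa_beta m (nonneg_unit_ball m) \<le> b / 2"
    unfolding pa_beta_def using assms
    by (subst Max_le_iff) (auto simp: pa_gamma_nonneg_unit_ball)
  then show ?thesis by (simp add: b_def)
qed

text \<open>Only the \<open>k\<close> coordinates above the threshold count, and Cauchy-Schwarz
  bounds their sum by \<open>sqrt k\<close>. The remaining inequality
  \<open>sqrt k - k * t \<le> \<beta>\<close> is the \<open>k\<close>-th constraint in the maximum
  defining \<beta>, cleared of denominators.\<close>

lemma sum_excess_le_pa_beta:
  assumes m: "1 \<le> m" and h: "h \<in> nonneg_unit_ball m"
  defines "\<beta> \<equiv> pa_beta m (nonneg_unit_ball m)"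
  shows "(\<Sum>i<m. max (h $ i - \<beta> * (1 / sqrt (real m))) 0) \<le> \<beta>"
proof -
  define t where "t = \<beta> * (1 / sqrt (real m))"
  define S where "S = {i\<in>{..<m}. t < h $ i}"
  define k where "k = card S"
  have S: "finite S" "S \<subseteq> {..<m}" by (auto simp: S_def)
  have "(\<Sum>i<m. max (h $ i - t) 0) = (\<Sum>i\<in>S. h $ i - t)"
    by (intro sum.mono_neutral_cong_right) (auto simp: S_def)
  also have "\<dots> = (\<Sum>i\<in>S. h $ i) - k * t"
    by (simp add: sum_subtractf k_def)
  also have "\<dots> \<le> sqrt (real k) - k * t"
    using sum_nonneg_unit_ball_le[OF h S(2)] by (simp add: k_def)
  also have "\<dots> \<le> \<beta>"
  \<comment> \<open>The maximum defining \<beta> starts at \<open>k = 1\<close>; without coordinates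
    above the threshold the claim is just that \<beta> is nonnegative.\<close>
  proof (cases "k = 0")
    case True
    then show ?thesis
      using pa_beta_nonneg_unit_ball_pos[OF m] by (simp add: \<beta>_def)
  next
    case False
    then have k: "1 \<le> k" "k \<le> m"
      using card_mono[OF _ S(2)] by (auto simp: k_def)
    have pos: "0 < 1 / sqrt (real m) + 1 / real k"
      using k by (intro add_pos_pos) auto
    have "1 / sqrt (real k) \<le> \<beta> * (1 / sqrt (real m) + 1 / real k)"
      using pa_beta_nonneg_unit_ball_ge[OF k] unfolding \<beta>_def pos_divide_le_eq[OF pos] .
    then have "k * (1 / sqrt (real k)) \<le> k * (\<beta> * (1 / sqrt (real m) + 1 / real k))"
      by (intro mult_left_mono) auto
    moreover have "k * (1 / sqrt (real k)) = sqrt (real k)" by (simp add: real_div_sqrt)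
    moreover have "k * (\<beta> * (1 / sqrt (real m) + 1 / real k)) = k * t + \<beta>"
      using k by (simp add: t_def distrib_left)
    ultimately show ?thesis by simp
  qed
  finally show ?thesis by (simp add: t_def)
qed

subsection \<open>The adjustable problem\<close>

text \<open>The constraints and the cost are homogeneous: multiplying a solution over
  \<open>S\<close> by \<open>a\<close> solves the problem over the scaled set, hence over any subset
  of it.\<close>

lemma z_AR_scale_le:
  assumes data: "ar_data m n A B c d" and a: "0 < a" and S': "S' \<subseteq> scale_set a S"
  shows "z_AR n A B c d S' \<le> ereal a * z_AR n A B c d S"
proof -
  \<comment> \<open>Dividing by \<open>a\<close> isolates the infimum on the right, so comparison
    with each feasible solution suffices; infeasibility over \<open>S\<close> is covered
    vacuously.\<close>
  have "z_AR n A B c d S' / ereal a \<le> z_AR n A B c d S"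
    unfolding z_AR_def[of n A B c d S]
  proof (rule Inf_greatest, clarify)
    fix x y assume feas: "ar_feasible n A B S x y"
    define y' where "y' h = a \<cdot>\<^sub>v y ((1 / a) \<cdot>\<^sub>v h)" for h
    have y': "\<exists>h\<in>S. h' = a \<cdot>\<^sub>v h \<and> y' h' = a \<cdot>\<^sub>v y h" if h': "h' \<in> S'" for h'
    proof -
      obtain h where h: "h \<in> S" "h' = a \<cdot>\<^sub>v h" using h' S' by (auto simp: scale_set_def)
      then have "(1 / a) \<cdot>\<^sub>v h' = h" using a by (simp add: smult_smult_assoc)
      then show ?thesis using h by (auto simp: y'_def)
    qed
    have x: "x \<in> nonneg_orthant n" using feas by (simp add: ar_feasible_def)
    have "ar_feasible n A B S' (a \<cdot>\<^sub>v x) y'"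
      unfolding ar_feasible_def
    proof (intro conjI ballI)
      show "a \<cdot>\<^sub>v x \<in> nonneg_orthant n"
        using x a by (simp add: smult_nonneg_orthant)
      fix h' assume "h' \<in> S'"
      then obtain h where h: "h \<in> S" "h' = a \<cdot>\<^sub>v h" "y' h' = a \<cdot>\<^sub>v y h" using y' by blast
      have yh: "y h \<in> nonneg_orthant n" and le: "h \<le> A *\<^sub>v x + B *\<^sub>v y h"
        using feas h by (auto simp: ar_feasible_def)
      show "y' h' \<in> nonneg_orthant n" using h yh a by (simp add: smult_nonneg_orthant)
      have car: "A \<in> carrier_mat m n" "B \<in> carrier_mat m n" "x \<in> carrier_vec n" "y h \<in> carrier_vec n"
        using data x yh by (auto simp: ar_data_def nonneg_orthant_iff)
      have "A *\<^sub>v (a \<cdot>\<^sub>v x) + B *\<^sub>v (a \<cdot>\<^sub>v y h) = a \<cdot>\<^sub>v (A *\<^sub>v x + B *\<^sub>v y h)"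
        using car by (simp add: mult_mat_vec smult_add_distrib_vec[of _ m])
      moreover have "a \<cdot>\<^sub>v h \<le> a \<cdot>\<^sub>v (A *\<^sub>v x + B *\<^sub>v y h)"
        using le a by (auto simp: less_eq_vec_def mult_left_mono simp del: index_add_vec)
      ultimately show "h' \<le> A *\<^sub>v (a \<cdot>\<^sub>v x) + B *\<^sub>v y' h'"
        unfolding h(3) by (simp only: h(2))
    qed
    then have "z_AR n A B c d S' \<le> worst_case_cost c d S' (a \<cdot>\<^sub>v x) y'"
      unfolding z_AR_def by (intro Inf_lower) auto
    also have "\<dots> \<le> ereal a * worst_case_cost c d S x y"
    proof -
      have "(SUP h\<in>S'. ereal (d \<bullet> y' h)) \<le> ereal a * (SUP h\<in>S. ereal (d \<bullet> y h))"
      proof (rule SUP_least)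
        fix h' assume "h' \<in> S'"
        then obtain h where h: "h \<in> S" "y' h' = a \<cdot>\<^sub>v y h" using y' by blast
        have "d \<bullet> y' h' = a * (d \<bullet> y h)"
          using h feas data by (auto simp: ar_feasible_def ar_data_def nonneg_orthant_iff)
        then have "ereal (d \<bullet> y' h') = ereal a * ereal (d \<bullet> y h)" by simp
        also have "\<dots> \<le> ereal a * (SUP h\<in>S. ereal (d \<bullet> y h))"
          using a h by (intro ereal_mult_left_mono SUP_upper) auto
        finally show "ereal (d \<bullet> y' h') \<le> ereal a * (SUP h\<in>S. ereal (d \<bullet> y h))" .
      qed
      moreover have "c \<bullet> (a \<cdot>\<^sub>v x) = a * (c \<bullet> x)"
        using x data by (auto simp: ar_data_def nonneg_orthant_iff)
      ultimately show ?thesis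
        using a by (simp add: worst_case_cost_def ereal_pos_distrib add_left_mono)
    qed
    finally show "z_AR n A B c d S' / ereal a \<le> worst_case_cost c d S x y"
      using a by (simp add: ereal_divide_le_pos)
  qed
  then show ?thesis using a by (simp add: ereal_divide_le_pos)
qed

text \<open>Turns the extended-real supremum into a real \<open>M\<close>: it is below \<infinity>
  because the optimum is, and at least 0 because the recourse costs are nonnegative and
  \<open>S\<close> is nonempty, which excludes the value -\<infinity> of an empty supremum.\<close>

lemma ar_optimal_policy_bound:
  assumes data: "ar_data m n A B c d" and opt: "ar_optimal n A B c d S x y" and "S \<noteq> {}"
  obtains M where "0 \<le> M" "\<And>h. h \<in> S \<Longrightarrow> d \<bullet> y h \<le> M" "z_AR n A B c d S = ereal (c \<bullet> x + M)"
proof -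
  define Z where "Z = (SUP h\<in>S. ereal (d \<bullet> y h))"
  have z: "ereal (c \<bullet> x) + Z = z_AR n A B c d S" "z_AR n A B c d S < \<infinity>"
    using opt by (auto simp: ar_optimal_def worst_case_cost_def Z_def)
  have upper: "ereal (d \<bullet> y h) \<le> Z" if "h \<in> S" for h
    unfolding Z_def using that by (rule SUP_upper)
  obtain h where h: "h \<in> S" using \<open>S \<noteq> {}\<close> by blast
  then have "y h \<in> nonneg_orthant n"
    using opt by (auto simp: ar_optimal_def ar_feasible_def)
  then have "0 \<le> d \<bullet> y h"
    using data by (auto simp: ar_data_def intro: scalar_prod_nonneg_orthant)
  then have "0 \<le> Z" using upper[OF h] by (meson ereal_less_eq(5) order_trans)
  moreover have "Z \<noteq> \<infinity>" using z by auto
  ultimately obtain M where "Z = ereal M" "0 \<le> M" by (cases Z) auto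
  then show ?thesis using that upper z by simp
qed

text \<open>Evaluates the policy under a linear functional: rows of \<open>B\<close> for
  feasibility, \<open>d\<close> for the cost.\<close>

lemma scalar_prod_finsum_smult:
  fixes u :: "real vec"
  assumes u: "u \<in> carrier_vec n" and I: "finite I" and p: "\<And>i. i \<in> I \<Longrightarrow> p i \<in> carrier_vec n"
  shows "u \<bullet> finsum_vec TYPE(real) n (\<lambda>i. w i \<cdot>\<^sub>v p i) I = (\<Sum>i\<in>I. w i * (u \<bullet> p i))"
proof -
  have p': "(\<lambda>i. w i \<cdot>\<^sub>v p i) \<in> I \<rightarrow> carrier_vec n" using p by auto
  have dim: "dim_vec (finsum_vec TYPE(real) n (\<lambda>i. w i \<cdot>\<^sub>v p i) I) = n"
    using finsum_vec_closed[OF p'] by auto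
  have dim': "dim_vec (p i) = n" if "i \<in> I" for i using p[OF that] by simp
  have "u \<bullet> finsum_vec TYPE(real) n (\<lambda>i. w i \<cdot>\<^sub>v p i) I
      = (\<Sum>j = 0..<n. \<Sum>i\<in>I. w i * (u $ j * p i $ j))"
    unfolding scalar_prod_def dim
  proof (intro sum.cong refl)
    fix j assume "j \<in> {0..<n}"
    then have "finsum_vec TYPE(real) n (\<lambda>i. w i \<cdot>\<^sub>v p i) I $ j = (\<Sum>i\<in>I. w i * p i $ j)"
      using dim' by (subst index_finsum_vec[OF I _ p']) auto
    then show "u $ j * finsum_vec TYPE(real) n (\<lambda>i. w i \<cdot>\<^sub>v p i) I $ j
        = (\<Sum>i\<in>I. w i * (u $ j * p i $ j))"
      by (simp add: sum_distrib_left mult_ac)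
  qed
  also have "\<dots> = (\<Sum>i\<in>I. \<Sum>j = 0..<n. w i * (u $ j * p i $ j))"
    by (rule sum.swap)
  also have "\<dots> = (\<Sum>i\<in>I. w i * (u \<bullet> p i))"
    by (intro sum.cong) (auto simp: scalar_prod_def dim' sum_distrib_left)
  finally show ?thesis .
qed

section \<open>Feasibility and cost of the piecewise affine solution\<close>

lemma piecewise_affine_approx:
  assumes m: "1 \<le> m" and data: "ar_data m n A B c d"
    and opt: "ar_optimal n A B c d (pa_set m (nonneg_unit_ball m)) x' y'"
  shows "ar_approx (real m powr (1/4)) n A B c d (nonneg_unit_ball m)
    (pa_x x') (pa_y m n (nonneg_unit_ball m) y')"
proof -
  define U where "U = nonneg_unit_ball m"
  define \<beta> where "\<beta> = pa_beta m U"
  define \<gamma> where "\<gamma> = 1 / sqrt (real m)"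
  define S where "S = pa_set m U"
  define p where "p i = y' (\<beta> \<cdot>\<^sub>v unit_vec m i)" for i
  define q where "q = y' ((\<beta> * \<gamma>) \<cdot>\<^sub>v ones_vec m)"
  define w where "w h i = max (h $ i - \<beta> * \<gamma>) 0" for h :: "real vec" and i
  have \<beta>: "0 < \<beta>" "2 * \<beta> \<le> real m powr (1/4)"
    using pa_beta_nonneg_unit_ball_pos[OF m] pa_beta_nonneg_unit_ball_le[OF m]
    by (simp_all add: \<beta>_def U_def)
  have gam: "pa_gamma U m = \<gamma>"
    using pa_gamma_nonneg_unit_ball[of m m] m by (simp add: U_def \<gamma>_def)
  have S_eq: "S = scale_set \<beta> (conv_basis m \<gamma>)"
    by (simp add: S_def pa_set_def gam \<beta>_def)
  have S_unit: "\<beta> \<cdot>\<^sub>v unit_vec m i \<in> S" if "i < m" for i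
    using that by (simp add: S_eq scale_set_def unit_vec_in_conv_basis)
  have S_ones: "(\<beta> * \<gamma>) \<cdot>\<^sub>v ones_vec m \<in> S"
    unfolding S_eq scale_set_def smult_smult_assoc[symmetric]
    by (intro imageI ones_vec_in_conv_basis)
  have S_sub: "S \<subseteq> scale_set \<beta> U"
    using conv_basis_subset_nonneg_unit_ball[OF m]
    by (auto simp: S_eq U_def \<gamma>_def scale_set_def)
  have feas: "ar_feasible n A B S x' y'"
    using opt by (simp add: ar_optimal_def S_def U_def)
  have A: "A \<in> carrier_mat m n" "0\<^sub>m m n \<le> A" and B: "B \<in> carrier_mat m n"
    and c: "c \<in> nonneg_orthant n" and d: "d \<in> nonneg_orthant n"
    using data by (simp_all add: ar_data_def)
  have A_ge: "0 \<le> A $$ (i, j)" if "i < m" "j < n" for i j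
  proof -
    have "0\<^sub>m m n $$ (i, j) \<le> A $$ (i, j)"
      using A(2) that unfolding less_eq_mat_def carrier_matD[OF A(1)] by blast
    then show ?thesis using that by simp
  qed
  have x: "x' \<in> nonneg_orthant n"
    using feas by (simp add: ar_feasible_def)
  have p: "p i \<in> nonneg_orthant n" if "i < m" for i
    using feas S_unit[OF that] unfolding ar_feasible_def p_def by blast
  have q: "q \<in> nonneg_orthant n"
    using feas S_ones unfolding ar_feasible_def q_def by blast
  have p_le: "\<beta> \<cdot>\<^sub>v unit_vec m i \<le> A *\<^sub>v x' + B *\<^sub>v p i" if "i < m" for i
    using feas S_unit[OF that] unfolding ar_feasible_def p_def by blast
  have q_le: "(\<beta> * \<gamma>) \<cdot>\<^sub>v ones_vec m \<le> A *\<^sub>v x' + B *\<^sub>v q"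
    using feas S_ones unfolding ar_feasible_def q_def by blast
  have carr: "x' \<in> carrier_vec n" "q \<in> carrier_vec n" "\<And>i. i < m \<Longrightarrow> p i \<in> carrier_vec n"
    "d \<in> carrier_vec n" "c \<in> carrier_vec n"
    using x p q c d nonneg_orthant_iff by blast+

  define F where "F h = finsum_vec TYPE(real) n (\<lambda>i. w h i \<cdot>\<^sub>v p i) {..<m}" for h
  have F: "F h \<in> carrier_vec n" for h
    unfolding F_def using carr by (intro finsum_vec_closed) auto
  have pa_y: "pa_y m n U y' h = (1 / \<beta>) \<cdot>\<^sub>v F h + q" for h
    by (simp add: pa_y_def Let_def gam F_def w_def p_def q_def flip: \<beta>_def)
  have scalar_pa_y: "u \<bullet> pa_y m n U y' h = (\<Sum>i<m. w h i / \<beta> * (u \<bullet> p i)) + u \<bullet> q"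
    if "u \<in> carrier_vec n" for u h
  proof -
    have "u \<bullet> F h = (\<Sum>i<m. w h i * (u \<bullet> p i))"
      unfolding F_def using that carr by (intro scalar_prod_finsum_smult) auto
    then show ?thesis
      using that F[of h] carr
      by (simp add: pa_y scalar_prod_add_distrib[of _ n] sum_distrib_left)
  qed
  have w: "0 \<le> w h i / \<beta>" for h i using \<beta> by (simp add: w_def)
  \<comment> \<open>The weights \<open>w h i / \<beta>\<close> form a subconvex combination of the
    vertices \<open>\<beta> \<cdot>\<^sub>v unit_vec m i\<close>.\<close>
  have W: "(\<Sum>i<m. w h i / \<beta>) \<le> 1" if "h \<in> U" for h
    using sum_excess_le_pa_beta[OF m, of h] that \<beta>
    by (simp add: w_def U_def \<gamma>_def \<beta>_def flip: sum_divide_distrib)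

  have "ar_feasible n A B U (pa_x x') (pa_y m n U y')"
    unfolding ar_feasible_def
  proof (intro conjI ballI)
    show "pa_x x' \<in> nonneg_orthant n" using x by (simp add: pa_x_def smult_nonneg_orthant)
    fix h assume h: "h \<in> U"
    have h_car: "h \<in> carrier_vec m" using h by (auto simp: U_def dest: nonneg_unit_ball_nonneg)
    have "0 \<le> F h $ j" if "j < n" for j
    proof -
      have "F h $ j = (\<Sum>i<m. (w h i \<cdot>\<^sub>v p i) $ j)"
        unfolding F_def using that carr by (intro index_finsum_vec) auto
      also have "\<dots> = (\<Sum>i<m. w h i * p i $ j)"
        using that carr(3) by (intro sum.cong) fastforce+
      also have "\<dots> \<ge> 0"
        using that p by (intro sum_nonneg mult_nonneg_nonneg) (auto simp: w_def nonneg_orthant_iff)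
      finally show ?thesis .
    qed
    then have "F h \<in> nonneg_orthant n" using F by (simp add: nonneg_orthant_iff)
    then show "pa_y m n U y' h \<in> nonneg_orthant n"
      unfolding pa_y using q \<beta> by (intro add_nonneg_orthant smult_nonneg_orthant) simp_all
    show "h \<le> A *\<^sub>v pa_x x' + B *\<^sub>v pa_y m n U y' h"
      unfolding less_eq_vec_def
    proof (intro conjI allI impI)
      show "dim_vec h = dim_vec (A *\<^sub>v pa_x x' + B *\<^sub>v pa_y m n U y' h)"
        using h_car B by simp
      fix r assume "r < dim_vec (A *\<^sub>v pa_x x' + B *\<^sub>v pa_y m n U y' h)"
      then have r: "r < m" using B by simp
      define X where "X = row A r \<bullet> x'"
      \<comment> \<open>Nonnegativity of \<open>A\<close> enters here: the weights may sum to less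
        than 1, and replacing that fraction of \<open>X\<close> by a full \<open>X\<close> must not
        decrease the bound.\<close>
      have X: "0 \<le> X"
        unfolding X_def using x A A_ge r
        by (intro scalar_prod_nonneg_orthant[of _ n]) (simp_all add: nonneg_orthant_iff)
      have unit_le: "\<beta> * (if r = i then 1 else 0) \<le> X + row B r \<bullet> p i" if "i < m" for i
        using less_eq_vecD[OF p_le[OF that], of r] that r A B by (simp add: X_def)
      have ones_le: "\<beta> * \<gamma> \<le> X + row B r \<bullet> q"
        using less_eq_vecD[OF q_le, of r] r A B by (simp add: X_def ones_vec_def)
      \<comment> \<open>In row \<open>r\<close> only the vertex with index \<open>r\<close>
        contributes, so the weighted vertices reproduce the excess.\<close>
      have "w h r = (\<Sum>i<m. w h i / \<beta> * (\<beta> * (if r = i then 1 else 0)))"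
        using r \<beta> by (simp add: if_distrib sum.delta cong: if_cong)
      also have "\<dots> \<le> (\<Sum>i<m. w h i / \<beta> * (X + row B r \<bullet> p i))"
        using unit_le w by (intro sum_mono mult_left_mono) auto
      also have "\<dots> = (\<Sum>i<m. w h i / \<beta>) * X + (\<Sum>i<m. w h i / \<beta> * (row B r \<bullet> p i))"
        by (simp add: distrib_left sum.distrib sum_distrib_right)
      also have "\<dots> \<le> X + (\<Sum>i<m. w h i / \<beta> * (row B r \<bullet> p i))"
        using mult_right_mono[OF W[OF h] X] by simp
      finally have "w h r \<le> X + (\<Sum>i<m. w h i / \<beta> * (row B r \<bullet> p i))" .
      moreover have "row B r \<in> carrier_vec n" using B r by simp
      ultimately have "w h r + \<beta> * \<gamma> \<le> 2 * X + row B r \<bullet> pa_y m n U y' h"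
        using ones_le by (simp only: scalar_pa_y)
      moreover have "h $ r \<le> w h r + \<beta> * \<gamma>" by (simp add: w_def)
      ultimately show "h $ r \<le> (A *\<^sub>v pa_x x' + B *\<^sub>v pa_y m n U y' h) $ r"
        using r A(1) B carr(1) by (simp add: X_def pa_x_def)
    qed
  qed
  moreover have "ereal (c \<bullet> pa_x x' + d \<bullet> pa_y m n U y' h)
      \<le> ereal (real m powr (1/4)) * z_AR n A B c d U" if h: "h \<in> U" for h
  proof -
    have "ar_optimal n A B c d S x' y'" using opt by (simp add: S_def U_def)
    then obtain M where M: "0 \<le> M" "\<And>h. h \<in> S \<Longrightarrow> d \<bullet> y' h \<le> M"
      and z: "z_AR n A B c d S = ereal (c \<bullet> x' + M)"
      using ar_optimal_policy_bound[OF data] S_ones by blast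
    \<comment> \<open>\<open>M\<close> bounds the recourse cost at every vertex: once for the
      subconvex combination, once more for \<open>q\<close>.\<close>
    have "(\<Sum>i<m. w h i / \<beta> * (d \<bullet> p i)) \<le> (\<Sum>i<m. w h i / \<beta> * M)"
      using w M(2) S_unit by (intro sum_mono mult_left_mono) (auto simp: p_def)
    also have "\<dots> = (\<Sum>i<m. w h i / \<beta>) * M" by (simp add: sum_distrib_right)
    also have "\<dots> \<le> 1 * M" using W[OF h] M(1) by (rule mult_right_mono)
    finally have "d \<bullet> pa_y m n U y' h \<le> 2 * M"
      using M(2)[OF S_ones] scalar_pa_y[of d h] carr by (simp add: q_def)
    moreover have "c \<bullet> pa_x x' = 2 * (c \<bullet> x')" using carr by (simp add: pa_x_def)
    ultimately have cost: "ereal (c \<bullet> pa_x x' + d \<bullet> pa_y m n U y' h) \<le> ereal 2 * z_AR n A B c d S"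
      by (simp add: z)
    have zS: "z_AR n A B c d S \<le> ereal \<beta> * z_AR n A B c d U"
      using z_AR_scale_le[OF data \<beta>(1) S_sub] .
    \<comment> \<open>Enlarging the factor \<open>2 * \<beta>\<close> to \<open>m powr (1/4)\<close>
      needs a nonnegative optimum over the ball, which follows from the one over \<open>S\<close>
      through \<open>zS\<close>.\<close>
    have "0 \<le> z_AR n A B c d S"
      using z M(1) scalar_prod_nonneg_orthant[OF c x] by simp
    then have "0 \<le> ereal \<beta> * z_AR n A B c d U" using zS by (rule order_trans)
    then have zU: "0 \<le> z_AR n A B c d U"
      using \<beta>(1) by (simp add: ereal_zero_le_0_iff)
    have "ereal 2 * z_AR n A B c d S \<le> ereal 2 * (ereal \<beta> * z_AR n A B c d U)"
      using zS by (intro ereal_mult_left_mono) auto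
    also have "\<dots> = ereal (2 * \<beta>) * z_AR n A B c d U"
      by (simp flip: mult.assoc)
    also have "\<dots> \<le> ereal (real m powr (1/4)) * z_AR n A B c d U"
      using \<beta>(2) zU by (intro ereal_mult_right_mono) auto
    finally show ?thesis using cost by (rule order_trans[rotated])
  qed
  ultimately show ?thesis by (simp add: ar_approx_def U_def)
qed

theorem mainTheorem4:
  shows "(\<forall>m\<ge>1. dominates m
            (scale_set (real m powr (1/4)) (conv_basis m (1 / sqrt (real m))))
            (nonneg_unit_ball m)) \<and>
         (\<exists>C::real. \<forall>m\<ge>1. \<forall>n A B c d x' y'.
            ar_data m n A B c d \<longrightarrow>
            ar_optimal n A B c d (pa_set m (nonneg_unit_ball m)) x' y' \<longrightarrow>
            ar_approx (C * real m powr (1/4)) n A B c d (nonneg_unit_ball m)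
              (pa_x x') (pa_y m n (nonneg_unit_ball m) y'))"
proof (intro conjI exI[of _ 1] allI impI)
  fix m :: nat assume "1 \<le> m"
  then show "dominates m (scale_set (real m powr (1/4)) (conv_basis m (1 / sqrt (real m))))
      (nonneg_unit_ball m)"
    by (rule dominates_nonneg_unit_ball)
next
  fix m n A B c d x' y'
  assume "1 \<le> m" "ar_data m n A B c d"
    "ar_optimal n A B c d (pa_set m (nonneg_unit_ball m)) x' y'"
  then show "ar_approx (1 * real m powr (1/4)) n A B c d (nonneg_unit_ball m)
      (pa_x x') (pa_y m n (nonneg_unit_ball m) y')"
    unfolding mult_1 by (rule piecewise_affine_approx)
qed

end
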